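(* Let $u,v\in\mathbb{N}$ and let $A$ be a $u\times v$ matrix with rational entries. Suppose that for every $CR$-set $B$ in $(\mathbb{Z},+)$, the set $\left\{\vec{y}\in\mathbb{Z}^{v}:A\vec{y}\in B^{u}\right\}$ is a $CR$-set in $(\mathbb{Z}^{v},+)$. Then for every essential $CR$-set $C$ in $(\mathbb{Z},+)$, the set $\left\{\vec{y}\in\mathbb{Z}^{v}:A\vec{y}\in C^{u}\right\}$ is an essential $CR$-set in $(\mathbb{Z}^{v},+)$.
   Context: $\mathbb{N}=\{1,2,3,\ldots\}$. Vectors are regarded as column vectors. Let $(S,+)$ be a commutative semigroup and $E\subseteq S$. $E$ is a $CR$-set (combinatorially rich set) in $S$ if and only if for each $k\in\mathbb{N}$ there exists $r\in\mathbb{N}$ such that for every $r\times k$ matrix $M=(m_{i,j})$ with entries from $S$ there exist $a\in S$ and a nonempty $H\subseteq\{1,2,\ldots,r\}$ such that for each $j\in\{1,2,\ldots,k\}$, $a+\sum_{t\in H}m_{t,j}\in E$. Let $\beta S$ be the Stone–Čech compactification of the discrete space $S$, viewed as the set of ultrafilters on $S$, with the operation extending $+$ given by: $E\in p+q$ if and only if $\{x\in S:-x+E\in q\}\in p$, where $-x+E=\{y\in S:x+y\in E\}$. For $E\subseteq S$, $\overline{E}=\{p\in\beta S:E\in p\}$. Let $CR(S)=\{p\in\beta S: \text{every } E\in p \text{ is a } CR\text{-set in } S\}$. A set $E\subseteq S$ is an essential $CR$-set in $S$ if and only if there is an idempotent $p=p+p$ in $\overline{E}\cap CR(S)$. *)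

theory Defs
  imports "HOL-Analysis.Analysis"
begin

(* A semigroup need not have a zero, so a + (SUM t:H. m t) is obtained by folding the terms m t,
   for t in H, onto the initial value a. *)
definition add_sum :: "'a::ab_semigroup_add \<Rightarrow> ('i \<Rightarrow> 'a) \<Rightarrow> 'i set \<Rightarrow> 'a" where
  "add_sum a m H = Finite_Set.fold (\<lambda>t s. m t + s) a H"

lemma add_sum_empty [simp]: "add_sum a m {} = a"
  by (simp add: add_sum_def)

lemma add_sum_insert [simp]:
  assumes "finite H" "t \<notin> H"
  shows "add_sum a m (insert t H) = m t + add_sum a m H"
proof -
  interpret comp_fun_commute "\<lambda>t s. m t + s"
    by standard (simp add: fun_eq_iff add.left_commute)
  show ?thesis
    using assms by (simp add: add_sum_def)
qed

lemma add_sum_eq: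
  fixes a :: "'a::comm_monoid_add"
  assumes "finite H"
  shows "add_sum a m H = a + (\<Sum>t\<in>H. m t)"
  using assms by (induction H rule: finite_induct) (simp_all add: ac_simps)

(* An r x k matrix is a function M of which only the entries M i j with i in {1..r} and
   j in {1..k} are used. *)
definition CR_set :: "'a::ab_semigroup_add set \<Rightarrow> bool" where
  "CR_set E \<longleftrightarrow>
    (\<forall>k::nat\<ge>1. \<exists>r::nat\<ge>1. \<forall>M :: nat \<Rightarrow> nat \<Rightarrow> 'a.
      \<exists>a H. H \<noteq> {} \<and> H \<subseteq> {1..r} \<and> (\<forall>j\<in>{1..k}. add_sum a (\<lambda>t. M t j) H \<in> E))"

(* Ultrafilters are represented by the library's filters: a set E belongs to p iff
   eventually (%x. x : E) p. The type of filters includes the improper filter bot. *)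
definition ultrafilters :: "'a filter set" where
  "ultrafilters =
    {p. p \<noteq> bot \<and> (\<forall>E. eventually (\<lambda>x. x \<in> E) p \<or> eventually (\<lambda>x. x \<in> - E) p)}"

definition beta_closure :: "'a set \<Rightarrow> 'a filter set" where
  "beta_closure E = {p \<in> ultrafilters. eventually (\<lambda>x. x \<in> E) p}"

definition beta_add :: "'a::ab_semigroup_add filter \<Rightarrow> 'a filter \<Rightarrow> 'a filter" where
  "beta_add p q = Abs_filter (\<lambda>P. eventually (\<lambda>x. eventually (\<lambda>y. P (x + y)) q) p)"

lemma eventually_beta_add:
  "eventually P (beta_add p q) \<longleftrightarrow> eventually (\<lambda>x. eventually (\<lambda>y. P (x + y)) q) p"
  unfolding beta_add_def
  by (rule eventually_Abs_filter, rule is_filter.intro)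
     (auto simp: eventually_conj_iff elim!: eventually_mono)

lemma mem_beta_add_iff:
  "eventually (\<lambda>z. z \<in> E) (beta_add p q) \<longleftrightarrow>
    eventually (\<lambda>x. x \<in> {x. eventually (\<lambda>y. y \<in> {y. x + y \<in> E}) q}) p"
  by (simp add: eventually_beta_add)

lemma beta_add_in_ultrafilters:
  assumes "p \<in> ultrafilters" "q \<in> ultrafilters"
  shows "beta_add p q \<in> ultrafilters"
proof -
  have neg: "\<not> eventually P r \<longleftrightarrow> eventually (\<lambda>x. \<not> P x) r"
    if r: "r \<in> ultrafilters" for r :: "'a filter" and P
  proof
    assume "\<not> eventually P r"
    with r show "eventually (\<lambda>x. \<not> P x) r"
      unfolding ultrafilters_def by (auto dest: spec[of _ "Collect P"])
  next
    assume ev: "eventually (\<lambda>x. \<not> P x) r"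
    show "\<not> eventually P r"
    proof
      assume "eventually P r"
      with ev have "eventually (\<lambda>x. False) r"
        by eventually_elim simp
      with r show False
        by (simp add: ultrafilters_def trivial_limit_def)
    qed
  qed
  have "\<not> eventually (\<lambda>_. False) (beta_add p q)"
    by (simp add: eventually_beta_add neg[OF assms(1)] neg[OF assms(2)])
  moreover have "eventually (\<lambda>x. x \<in> E) (beta_add p q) \<or> eventually (\<lambda>x. x \<in> - E) (beta_add p q)" for E
    by (simp add: eventually_beta_add flip: neg[OF assms(1)] neg[OF assms(2)])
  ultimately show ?thesis
    by (auto simp: ultrafilters_def)
qed

definition CR_ultrafilters :: "'a::ab_semigroup_add filter set" where
  "CR_ultrafilters = {p \<in> ultrafilters. \<forall>E. eventually (\<lambda>x. x \<in> E) p \<longrightarrow> CR_set E}"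

definition essential_CR_set :: "'a::ab_semigroup_add set \<Rightarrow> bool" where
  "essential_CR_set E \<longleftrightarrow> (\<exists>p \<in> beta_closure E \<inter> CR_ultrafilters. p = beta_add p p)"

(* The integer vectors y with A y in B^u; the product A y is computed over the rationals. *)
definition int_preimage :: "rat ^ 'v ^ 'u \<Rightarrow> int set \<Rightarrow> (int ^ 'v) set" where
  "int_preimage A B =
    {y. \<forall>i. (A *v (\<chi> j. rat_of_int (y $ j))) $ i \<in> rat_of_int ` B}"

end

theory Submission
  imports Defs
begin

text \<open>
  Let \<open>p\<close> be an idempotent ultrafilter of CR-sets containing \<open>C\<close>. The sets whose complement
  meets the preimage of some \<open>B \<in> p\<close> in a set that is not CR form a filter \<open>F\<close>, because CR-sets
  are partition regular (by the Hales--Jewett theorem). Idempotency of \<open>p\<close> gives \<open>F + F \<le> F\<close>, and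
  every proper filter with this property is refined by an idempotent ultrafilter. All members of
  an ultrafilter refining \<open>F\<close> are CR-sets, and the preimage of \<open>C\<close> is one of them.
\<close>

section \<open>The Hales--Jewett theorem\<close>

text \<open>A variable word is a list of options in which \<open>None\<close> marks the positions of the variable.\<close>

definition subst_word :: "'a \<Rightarrow> 'a option list \<Rightarrow> 'a list" where
  "subst_word l v = map (case_option l id) v"

lemma subst_word_append [simp]: "subst_word l (u @ v) = subst_word l u @ subst_word l v"
  by (simp add: subst_word_def)

lemma subst_word_map_Some [simp]: "subst_word l (map Some w) = w"
  by (simp add: subst_word_def comp_def)

lemma nth_subst_word:
  "i < length v \<Longrightarrow> subst_word l v ! i = (case v ! i of None \<Rightarrow> l | Some a \<Rightarrow> a)"
  by (simp add: subst_word_def split: option.split)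

definition words :: "nat \<Rightarrow> nat \<Rightarrow> nat list set" where
  "words k n = {w. set w \<subseteq> {..<k} \<and> length w = n}"

definition var_words :: "nat \<Rightarrow> nat \<Rightarrow> nat option list set" where
  "var_words k n = {v. set v \<subseteq> insert None (Some ` {..<k}) \<and> None \<in> set v \<and> length v = n}"

lemma finite_words: "finite (words k n)"
  unfolding words_def by (rule finite_lists_length_eq) simp

lemma subst_word_in_words:
  assumes "v \<in> var_words k n" "l < k"
  shows "subst_word l v \<in> words k n"
proof -
  have "case_option l id ` set v \<subseteq> case_option l id ` insert None (Some ` {..<k})"
    using assms(1) by (intro image_mono) (simp add: var_words_def)
  also have "\<dots> \<subseteq> {..<k}"
    using assms(2) by auto
  finally show ?thesis
    using assms(1) by (simp add: words_def var_words_def subst_word_def)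
qed

lemma var_words_mono: "k \<le> k' \<Longrightarrow> var_words k n \<subseteq> var_words k' n"
  unfolding var_words_def by (auto 0 3 dest: order.strict_trans2)

lemma words_append: "u \<in> words k m \<Longrightarrow> w \<in> words k n \<Longrightarrow> u @ w \<in> words k (m + n)"
  unfolding words_def by auto

lemma var_words_append_left:
  "u \<in> words k m \<Longrightarrow> v \<in> var_words k n \<Longrightarrow> map Some u @ v \<in> var_words k (m + n)"
  unfolding words_def var_words_def by auto

lemma var_words_append_right:
  "v \<in> var_words k m \<Longrightarrow> w \<in> words k n \<Longrightarrow> v @ map Some w \<in> var_words k (m + n)"
  unfolding words_def var_words_def by auto

lemma var_words_append:
  "v \<in> var_words k m \<Longrightarrow> v' \<in> var_words k n \<Longrightarrow> v @ v' \<in> var_words k (m + n)"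
  unfolding var_words_def by auto

section \<open>Monochromatic lines and colour focusing\<close>

definition mono_line :: "nat \<Rightarrow> nat \<Rightarrow> (nat list \<Rightarrow> 'c) \<Rightarrow> bool" where
  "mono_line k n \<kappa> \<longleftrightarrow> (\<exists>v\<in>var_words k n. \<exists>c. \<forall>l<k. \<kappa> (subst_word l v) = c)"

definition HJ :: "nat \<Rightarrow> nat \<Rightarrow> nat \<Rightarrow> bool" where
  "HJ k c n \<longleftrightarrow> (\<forall>\<kappa> :: nat list \<Rightarrow> nat. (\<forall>w\<in>words k n. \<kappa> w < c) \<longrightarrow> mono_line k n \<kappa>)"

lemma HJ_D: "HJ k c n \<Longrightarrow> (\<And>w. w \<in> words k n \<Longrightarrow> \<kappa> w < c) \<Longrightarrow> mono_line k n \<kappa>"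
  unfolding HJ_def by auto

text \<open>The colour-focused lines of the combinatorial proof of Hales-Jewett: since all of them
  end in the same word \<open>f\<close>, the colour of \<open>f\<close> either completes one of them
  to a monochromatic line or is a new colour.\<close>

definition focused :: "nat \<Rightarrow> nat \<Rightarrow> (nat list \<Rightarrow> 'c) \<Rightarrow> nat list \<Rightarrow> 'c set \<Rightarrow> bool" where
  "focused k n \<kappa> f K \<longleftrightarrow> (\<forall>c\<in>K. \<exists>v\<in>var_words (Suc k) n.
     subst_word k v = f \<and> (\<forall>l<k. \<kappa> (subst_word l v) = c))"

text \<open>Colouring \<open>w\<close> by the whole function \<open>\<kappa> w\<close> on the finite
  set \<open>U\<close> uses only finitely many colours, which \<open>e\<close> codes as numbers.
  \<open>restrict\<close> makes two functions equal as soon as they agree on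
  \<open>U\<close>.\<close>

lemma HJ_product:
  assumes "\<And>c. \<exists>n. HJ k c n" and "finite U"
  shows "\<exists>n. \<forall>\<kappa> :: nat list \<Rightarrow> 'a \<Rightarrow> nat. (\<forall>w\<in>words k n. \<forall>u\<in>U. \<kappa> w u < c) \<longrightarrow>
     mono_line k n (\<lambda>w. restrict (\<kappa> w) U)"
proof -
  have "finite (U \<rightarrow>\<^sub>E {..<c})"
    using assms(2) by (intro finite_PiE) auto
  then obtain N and e :: "('a \<Rightarrow> nat) \<Rightarrow> nat"
    where e: "e ` (U \<rightarrow>\<^sub>E {..<c}) = {i. i < N}" "inj_on e (U \<rightarrow>\<^sub>E {..<c})"
    using finite_imp_inj_to_nat_seg by metis
  obtain n where n: "HJ k N n"
    using assms(1) by blast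
  have "mono_line k n (\<lambda>w. restrict (\<kappa> w) U)"
    if \<kappa>: "\<forall>w\<in>words k n. \<forall>u\<in>U. \<kappa> w u < c" for \<kappa> :: "nat list \<Rightarrow> 'a \<Rightarrow> nat"
  proof -
    have mem: "restrict (\<kappa> w) U \<in> U \<rightarrow>\<^sub>E {..<c}" if "w \<in> words k n" for w
      using \<kappa> that by auto
    then have "\<forall>w\<in>words k n. e (restrict (\<kappa> w) U) < N"
      using e(1) by blast
    then have "mono_line k n (\<lambda>w. e (restrict (\<kappa> w) U))"
      by (intro HJ_D[OF n]) blast
    then obtain v d where v: "v \<in> var_words k n"
      and d: "\<And>l. l < k \<Longrightarrow> e (restrict (\<kappa> (subst_word l v)) U) = d"
      unfolding mono_line_def by blast
    have "\<forall>l<k. restrict (\<kappa> (subst_word l v)) U = inv_into (U \<rightarrow>\<^sub>E {..<c}) e d"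
      using d e(2) mem subst_word_in_words[OF v] by (metis inv_into_f_f)
    with v show ?thesis
      unfolding mono_line_def by blast
  qed
  then show ?thesis by blast
qed

text \<open>The colouring does not see which letter below \<open>k\<close> is put into the prefix
  \<open>V\<close>. An old line \<open>v\<close> therefore keeps its colour when it becomes
  \<open>V @ v\<close>, with the variable moving in both blocks. The line that moves in
  \<open>V\<close> only, with suffix \<open>f\<close>, supplies the additional colour. All these
  lines end in \<open>subst_word k V @ f\<close>.\<close>

lemma focused_extend:
  assumes k: "0 < k" and V: "V \<in> var_words k m"
    and indep: "\<And>l u. l < k \<Longrightarrow> u \<in> words (Suc k) n \<Longrightarrow>
      \<kappa> (subst_word l V @ u) = \<kappa> (subst_word 0 V @ u)"
    and f: "f \<in> words (Suc k) n"
    and foc: "focused k n (\<lambda>u. \<kappa> (subst_word 0 V @ u)) f K"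
  shows "focused k (m + n) \<kappa> (subst_word k V @ f) (insert (\<kappa> (subst_word 0 V @ f)) K)"
  unfolding focused_def
proof
  have V': "V \<in> var_words (Suc k) m"
    using V var_words_mono[of k "Suc k"] by auto
  fix c assume "c \<in> insert (\<kappa> (subst_word 0 V @ f)) K"
  then consider "c = \<kappa> (subst_word 0 V @ f)" | "c \<in> K" by blast
  then show "\<exists>v\<in>var_words (Suc k) (m + n). subst_word k v = subst_word k V @ f \<and>
      (\<forall>l<k. \<kappa> (subst_word l v) = c)"
  proof cases
    case 1
    have "\<kappa> (subst_word l (V @ map Some f)) = c" if "l < k" for l
      using 1 indep[OF that f] by simp
    then show ?thesis
      by (intro bexI[OF _ var_words_append_right[OF V' f]]) simp
  next
    case 2
    with foc obtain v where v: "v \<in> var_words (Suc k) n" "subst_word k v = f"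
      "\<And>l. l < k \<Longrightarrow> \<kappa> (subst_word 0 V @ subst_word l v) = c"
      unfolding focused_def by blast
    have "\<kappa> (subst_word l (V @ v)) = c" if "l < k" for l
    proof -
      have "subst_word l v \<in> words (Suc k) n"
        using subst_word_in_words[OF v(1)] that by simp
      then show ?thesis
        using indep[OF that] v(3)[OF that] by simp
    qed
    with v(2) show ?thesis
      by (intro bexI[OF _ var_words_append[OF V' v(1)]]) simp
  qed
qed

text \<open>Induction on the number \<open>s\<close> of focused colours: a prefix long enough for
  \<open>HJ_product\<close> is put in front of words that already focus \<open>s\<close> colours.
  The prefix uses only \<open>k\<close> letters, so Hales-Jewett for \<open>k\<close>
  suffices.\<close>

lemma color_focusing:
  assumes k: "0 < k" and HJ: "\<And>c. \<exists>n. HJ k c n"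
  shows "\<exists>n. \<forall>\<kappa> :: nat list \<Rightarrow> nat. (\<forall>w\<in>words (Suc k) n. \<kappa> w < c) \<longrightarrow>
    mono_line (Suc k) n \<kappa> \<or>
    (\<exists>f\<in>words (Suc k) n. \<exists>K. finite K \<and> card K = s \<and> focused k n \<kappa> f K)"
proof (induction s)
  case 0
  have "[] \<in> words (Suc k) 0"
    by (simp add: words_def)
  then show ?case
    by (intro exI[of _ 0]) (auto simp: focused_def intro!: bexI[of _ "[]"] exI[of _ "{}"])
next
  case (Suc s)
  then obtain n where n: "\<And>\<kappa> :: nat list \<Rightarrow> nat. \<forall>w\<in>words (Suc k) n. \<kappa> w < c \<Longrightarrow>
    mono_line (Suc k) n \<kappa> \<or>
    (\<exists>f\<in>words (Suc k) n. \<exists>K. finite K \<and> card K = s \<and> focused k n \<kappa> f K)"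
    by blast
  obtain m where m: "\<And>\<kappa> :: nat list \<Rightarrow> nat list \<Rightarrow> nat.
    \<forall>w\<in>words k m. \<forall>u\<in>words (Suc k) n. \<kappa> w u < c \<Longrightarrow>
    mono_line k m (\<lambda>w. restrict (\<kappa> w) (words (Suc k) n))"
    using HJ_product[OF HJ finite_words] by metis
  have words_le: "words k m \<subseteq> words (Suc k) m"
    by (auto simp: words_def)
  show ?case
  proof (intro exI[of _ "m + n"] allI impI)
    fix \<kappa> :: "nat list \<Rightarrow> nat"
    assume \<kappa>: "\<forall>w\<in>words (Suc k) (m + n). \<kappa> w < c"
    \<comment> \<open>Each prefix is coloured by the colouring that it induces on all suffixes of
      length \<open>n\<close>.\<close>
    have "mono_line k m (\<lambda>w. restrict (\<lambda>u. \<kappa> (w @ u)) (words (Suc k) n))"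
      using \<kappa> words_append words_le by (intro m) blast
    then obtain V g where V: "V \<in> var_words k m"
      and g: "\<And>l. l < k \<Longrightarrow> restrict (\<lambda>u. \<kappa> (subst_word l V @ u)) (words (Suc k) n) = g"
      unfolding mono_line_def by blast
    have indep: "\<kappa> (subst_word l V @ u) = \<kappa> (subst_word 0 V @ u)"
      if "l < k" "u \<in> words (Suc k) n" for l u
      using g[OF that(1)] g[OF k] that(2) by (metis restrict_apply')
    define w where "w = subst_word 0 V"
    have w: "w \<in> words (Suc k) m"
      using subst_word_in_words[OF V k] words_le w_def by blast
    have lift: "mono_line (Suc k) (m + n) \<kappa>" if "mono_line (Suc k) n (\<lambda>u. \<kappa> (w @ u))"
    proof -
      from that obtain v d where "v \<in> var_words (Suc k) n"
        "\<forall>l<Suc k. \<kappa> (w @ subst_word l v) = d"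
        unfolding mono_line_def by blast
      then show ?thesis
        using var_words_append_left[OF w] unfolding mono_line_def
        by (intro bexI[of _ "map Some w @ v"]) auto
    qed
    have "\<forall>u\<in>words (Suc k) n. \<kappa> (w @ u) < c"
      using \<kappa> words_append[OF w] by blast
    from n[OF this] consider "mono_line (Suc k) n (\<lambda>u. \<kappa> (w @ u))"
      | f K where "f \<in> words (Suc k) n" "finite K" "card K = s"
          "focused k n (\<lambda>u. \<kappa> (w @ u)) f K"
      by blast
    then show "mono_line (Suc k) (m + n) \<kappa> \<or>
      (\<exists>f\<in>words (Suc k) (m + n). \<exists>K. finite K \<and> card K = Suc s \<and> focused k (m + n) \<kappa> f K)"
    proof cases
      case 1
      then show ?thesis using lift by blast
    next
      case (2 f K)
      show ?thesis
      proof (cases "\<kappa> (w @ f) \<in> K")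
        \<comment> \<open>The focus already has a focused colour, so it is the missing last point of
          the line of that colour.\<close>
        case True
        with 2 obtain v where v: "v \<in> var_words (Suc k) n" "subst_word k v = f"
          "\<forall>l<k. \<kappa> (w @ subst_word l v) = \<kappa> (w @ f)"
          unfolding focused_def by blast
        then have "mono_line (Suc k) n (\<lambda>u. \<kappa> (w @ u))"
          unfolding mono_line_def by (auto simp: less_Suc_eq)
        then show ?thesis using lift by blast
      next
        case False
        have "focused k (m + n) \<kappa> (subst_word k V @ f) (insert (\<kappa> (w @ f)) K)"
          unfolding w_def
          by (rule focused_extend[OF k V indep 2(1) 2(4)[unfolded w_def]])
        moreover have "subst_word k V @ f \<in> words (Suc k) (m + n)"
          using V var_words_mono[of k "Suc k" m] 2(1)
          by (intro words_append subst_word_in_words) auto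
        moreover have "finite (insert (\<kappa> (w @ f)) K)" "card (insert (\<kappa> (w @ f)) K) = Suc s"
          using 2(2,3) False by auto
        ultimately show ?thesis by blast
      qed
    qed
  qed
qed

text \<open>Induction on the alphabet: with \<open>c\<close> colours it is impossible to focus
  \<open>c + 1\<close> colours, so \<open>color_focusing\<close> must produce a line. An alphabet
  with one letter is treated separately, because focusing needs at least one letter before the last;
  there every line has a single point.\<close>

theorem Hales_Jewett: "\<exists>n. HJ k c n"
proof (induction k arbitrary: c)
  case 0
  have "[None] \<in> var_words 0 1"
    by (simp add: var_words_def)
  then show ?case
    by (auto simp: HJ_def mono_line_def)
next
  case (Suc k)
  show ?case
  proof (cases "k = 0")
    case True
    have "[None] \<in> var_words (Suc 0) 1"
      by (simp add: var_words_def)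
    with True show ?thesis
      by (auto simp: HJ_def mono_line_def)
  next
    case False
    then obtain n where n: "\<And>\<kappa> :: nat list \<Rightarrow> nat. \<forall>w\<in>words (Suc k) n. \<kappa> w < c \<Longrightarrow>
      mono_line (Suc k) n \<kappa> \<or>
      (\<exists>f\<in>words (Suc k) n. \<exists>K. finite K \<and> card K = Suc c \<and> focused k n \<kappa> f K)"
      using color_focusing[of k c "Suc c"] Suc by blast
    have "HJ (Suc k) c n"
      unfolding HJ_def
    proof (intro allI impI)
      fix \<kappa> :: "nat list \<Rightarrow> nat"
      assume \<kappa>: "\<forall>w\<in>words (Suc k) n. \<kappa> w < c"
      have "\<not> (finite K \<and> card K = Suc c \<and> focused k n \<kappa> f K)" for f K
      proof
        assume K: "finite K \<and> card K = Suc c \<and> focused k n \<kappa> f K"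
        \<comment> \<open>Each focused colour is attained at the point of its line with letter 0,
          which exists because \<open>k\<close> is positive.\<close>
        have "K \<subseteq> {..<c}"
        proof
          fix d assume "d \<in> K"
          with K obtain v where "v \<in> var_words (Suc k) n" "\<forall>l<k. \<kappa> (subst_word l v) = d"
            unfolding focused_def by blast
          then show "d \<in> {..<c}"
            using \<kappa> subst_word_in_words[of v "Suc k" n 0] False by auto
        qed
        with K show False
          using card_mono[of "{..<c}" K] by simp
      qed
      with n[OF \<kappa>] show "mono_line (Suc k) n \<kappa>" by blast
    qed
    then show ?thesis ..
  qed
qed

section \<open>Partition regularity of CR-sets\<close>

definition CR_bound :: "'a::ab_semigroup_add set \<Rightarrow> nat \<Rightarrow> nat \<Rightarrow> bool" where
  "CR_bound E k r \<longleftrightarrow> (\<forall>M :: nat \<Rightarrow> nat \<Rightarrow> 'a.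
    \<exists>a H. H \<noteq> {} \<and> H \<subseteq> {1..r} \<and> (\<forall>j\<in>{1..k}. add_sum a (\<lambda>t. M t j) H \<in> E))"

lemma CR_set_iff: "CR_set E \<longleftrightarrow> (\<forall>k\<ge>1. \<exists>r\<ge>1. CR_bound E k r)"
  unfolding CR_set_def CR_bound_def ..

lemma CR_boundE:
  fixes M :: "nat \<Rightarrow> nat \<Rightarrow> 'a::ab_semigroup_add"
  assumes "CR_bound E k r"
  obtains a H where "H \<noteq> {}" "H \<subseteq> {1..r}"
    "\<And>j. j \<in> {1..k} \<Longrightarrow> add_sum a (\<lambda>t. M t j) H \<in> E"
proof -
  obtain a H where "H \<noteq> {}" "H \<subseteq> {1..r}" "\<forall>j\<in>{1..k}. add_sum a (\<lambda>t. M t j) H \<in> E"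
    using assms[unfolded CR_bound_def, THEN spec, of M] by (elim exE conjE)
  then show ?thesis
    by (intro that[of H a]) auto
qed

lemma not_CR_boundE:
  fixes E :: "'a::ab_semigroup_add set"
  assumes "\<not> CR_bound E k r"
  obtains M :: "nat \<Rightarrow> nat \<Rightarrow> 'a" where "\<And>a H. H \<noteq> {} \<Longrightarrow> H \<subseteq> {1..r} \<Longrightarrow>
    \<exists>j\<in>{1..k}. add_sum a (\<lambda>t. M t j) H \<notin> E"
proof -
  obtain M :: "nat \<Rightarrow> nat \<Rightarrow> 'a" where "\<not> (\<exists>a H. H \<noteq> {} \<and> H \<subseteq> {1..r} \<and>
      (\<forall>j\<in>{1..k}. add_sum a (\<lambda>t. M t j) H \<in> E))"
    using assms unfolding CR_bound_def not_all by (elim exE)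
  then show ?thesis
    by (intro that[of M]) auto
qed

lemma CR_bound_mono:
  assumes "CR_bound E k r" "E \<subseteq> E'"
  shows "CR_bound E' k r"
  unfolding CR_bound_def
proof
  fix M :: "nat \<Rightarrow> nat \<Rightarrow> 'a"
  obtain a H where "H \<noteq> {}" "H \<subseteq> {1..r}"
    "\<And>j. j \<in> {1..k} \<Longrightarrow> add_sum a (\<lambda>t. M t j) H \<in> E"
    by (rule CR_boundE[OF assms(1), of M], rule that)
  then show "\<exists>a H. H \<noteq> {} \<and> H \<subseteq> {1..r} \<and>
      (\<forall>j\<in>{1..k}. add_sum a (\<lambda>t. M t j) H \<in> E')"
    by (intro exI[of _ a] exI[of _ H] conjI ballI subsetD[OF assms(2)])
qed

lemma CR_set_mono: "CR_set E \<Longrightarrow> E \<subseteq> E' \<Longrightarrow> CR_set E'"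
  unfolding CR_set_iff using CR_bound_mono by blast

lemma not_CR_set_empty: "\<not> CR_set {}"
proof -
  have "\<not> CR_bound {} 1 r" for r
    by (simp add: CR_bound_def)
  then show ?thesis
    unfolding CR_set_iff by blast
qed

lemma add_sum_add:
  assumes "finite H"
  shows "add_sum (x + a) m H = x + add_sum a m H"
  using assms by (induction H rule: finite_induct) (simp_all add: add.left_commute)

lemma CR_bound_translate:
  assumes "CR_bound {y. x + y \<in> E} k r"
  shows "CR_bound E k r"
  unfolding CR_bound_def
proof
  fix M :: "nat \<Rightarrow> nat \<Rightarrow> 'a"
  obtain a H where H: "H \<noteq> {}" "H \<subseteq> {1..r}"
    and "\<And>j. j \<in> {1..k} \<Longrightarrow> add_sum a (\<lambda>t. M t j) H \<in> {y. x + y \<in> E}"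
    by (rule CR_boundE[OF assms, of M], rule that)
  moreover have "finite H"
    using H(2) finite_subset by blast
  ultimately show "\<exists>a H. H \<noteq> {} \<and> H \<subseteq> {1..r} \<and> (\<forall>j\<in>{1..k}. add_sum a (\<lambda>t. M t j) H \<in> E)"
    by (intro exI[of _ "x + a"] exI[of _ H]) (auto simp: add_sum_add)
qed

text \<open>The shift by \<open>x\<close> is absorbed by the starting element \<open>a\<close>. Read
  contrapositively, translates of a set that is not CR are not CR, which is what the additivity of
  the filter of the main proof requires.\<close>

lemma CR_set_translate: "CR_set {y. x + y \<in> E} \<Longrightarrow> CR_set E"
  unfolding CR_set_iff using CR_bound_translate by blast

text \<open>Numbers the pairs in consecutive blocks of length \<open>n\<close>; quotient and
  remainder recover the pair. Rows \<open>t\<close> are counted from 1 and positions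
  \<open>i\<close> from 0, hence \<open>t - 1\<close> and \<open>Suc\<close>.\<close>

lemma inj_on_block: "inj_on (\<lambda>(t, i). Suc ((t - 1) * n + i)) ({1..} \<times> {..<n})"
proof -
  have *: "t = t' \<and> i = i'" if "Suc 0 \<le> t" "i < n" "Suc 0 \<le> t'" "i' < n"
    and eq: "(t - Suc 0) * n + i = (t' - Suc 0) * n + i'" for t i t' i' :: nat
  proof -
    have "((t - Suc 0) * n + i) div n = t - Suc 0" "((t - Suc 0) * n + i) mod n = i"
      "((t' - Suc 0) * n + i') div n = t' - Suc 0" "((t' - Suc 0) * n + i') mod n = i'"
      using that(2,4) by auto
    with that show ?thesis
      by (metis le_add_diff_inverse)
  qed
  show ?thesis
  proof (rule inj_onI)
    fix x y :: "nat \<times> nat"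
    assume "x \<in> {1..} \<times> {..<n}" "y \<in> {1..} \<times> {..<n}"
      "(case x of (t, i) \<Rightarrow> Suc ((t - 1) * n + i)) = (case y of (t, i) \<Rightarrow> Suc ((t - 1) * n + i))"
    then show "x = y"
      using *[of "fst x" "snd x" "fst y" "snd y"]
      by (simp add: prod_eq_iff mem_Times_iff case_prod_beta)
  qed
qed

lemma block_le:
  assumes "1 \<le> t" "t \<le> r" "i < (n::nat)"
  shows "Suc ((t - 1) * n + i) \<le> r * n"
proof -
  have "Suc ((t - 1) * n + i) \<le> Suc (t - 1) * n"
    using assms(3) by simp
  also have "\<dots> \<le> r * n"
    using assms(1,2) by (intro mult_le_mono1) simp
  finally show ?thesis .
qed

text \<open>If both sets fail, take a bad matrix with \<open>r * n\<close> rows for each and use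
  their columns together as the letters of an alphabet. Each word of length \<open>n\<close> yields
  one column of a matrix with \<open>r\<close> rows, whose row \<open>t\<close> sums the entries
  that the word selects in block \<open>t\<close>. A monochromatic line among the resulting sums is
  a family of sums over one index set \<open>G\<close> with one starting element \<open>b\<close>,
  which contradicts one of the bad matrices.\<close>

lemma CR_set_Un:
  fixes E1 E2 :: "'a::comm_monoid_add set"
  assumes CR: "CR_set (E1 \<union> E2)"
  shows "CR_set E1 \<or> CR_set E2"
proof (rule ccontr)
  assume "\<not> (CR_set E1 \<or> CR_set E2)"
  then obtain k1 k2 where k: "1 \<le> k1" "1 \<le> k2"
    and bad: "\<forall>r\<ge>1. \<not> CR_bound E1 k1 r" "\<forall>r\<ge>1. \<not> CR_bound E2 k2 r"
    by (auto simp only: CR_set_iff de_Morgan_disj not_all not_imp not_ex de_Morgan_conj imp_conv_disj)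
  define k where "k = k1 + k2"
  obtain n where n: "HJ k 2 n"
    using Hales_Jewett by blast
  \<comment> \<open>A constant colouring already forces a variable word of length \<open>n\<close>,
    and such a word is not empty.\<close>
  have "mono_line k n (\<lambda>_. 0 :: nat)"
    by (rule HJ_D[OF n]) simp
  then have n_pos: "0 < n"
    unfolding mono_line_def var_words_def by auto
  define N where "N = card (words k n)"
  have "replicate n 0 \<in> words k n"
    using k by (simp add: words_def k_def subset_iff)
  then have "N \<noteq> 0"
    unfolding N_def using finite_words[of k n] by auto
  then have "1 \<le> N"
    by simp
  obtain e where e: "bij_betw e {1..N} (words k n)"
    using ex_bij_betw_nat_finite_1[OF finite_words] N_def by blast
  obtain r where "1 \<le> r" and r: "CR_bound (E1 \<union> E2) N r"
    using CR \<open>1 \<le> N\<close> unfolding CR_set_iff by blast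
  have "1 \<le> r * n"
    using \<open>1 \<le> r\<close> n_pos by simp
  obtain M1 where M1: "\<And>a H. H \<noteq> {} \<Longrightarrow> H \<subseteq> {1..r * n} \<Longrightarrow>
      \<exists>j\<in>{1..k1}. add_sum a (\<lambda>t. M1 t j) H \<notin> E1"
    by (rule not_CR_boundE[OF bad(1)[rule_format, OF \<open>1 \<le> r * n\<close>]], rule that)
  obtain M2 where M2: "\<And>a H. H \<noteq> {} \<Longrightarrow> H \<subseteq> {1..r * n} \<Longrightarrow>
      \<exists>j\<in>{1..k2}. add_sum a (\<lambda>t. M2 t j) H \<notin> E2"
    by (rule not_CR_boundE[OF bad(2)[rule_format, OF \<open>1 \<le> r * n\<close>]], rule that)
  \<comment> \<open>Letters count from 0 and matrix columns from 1: the first \<open>k1\<close>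
    letters are the columns of \<open>M1\<close>, the other \<open>k2\<close> letters those of
    \<open>M2\<close>.\<close>
  define M where "M s l = (if l < k1 then M1 s (Suc l) else M2 s (Suc (l - k1)))" for s l
  define pos where "pos = (\<lambda>(t, i). Suc ((t - 1) * n + i))"
  obtain a H where H: "H \<noteq> {}" "H \<subseteq> {1..r}" and
    aH: "\<And>j. j \<in> {1..N} \<Longrightarrow> add_sum a (\<lambda>t. \<Sum>i<n. M (pos (t, i)) (e j ! i)) H \<in> E1 \<union> E2"
    by (rule CR_boundE[OF r, where M = "\<lambda>t j. \<Sum>i<n. M (pos (t, i)) (e j ! i)"], rule that)
  have fin: "finite H"
    using H finite_subset by blast
  define S where "S w = a + (\<Sum>(t, i)\<in>H \<times> {..<n}. M (pos (t, i)) (w ! i))" for w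
  have S_mem: "S w \<in> E1 \<union> E2" if "w \<in> words k n" for w
  proof -
    obtain j where "j \<in> {1..N}" "e j = w"
      using e \<open>w \<in> words k n\<close> by (metis bij_betw_iff_bijections)
    with aH[of j] show ?thesis
      by (simp add: S_def add_sum_eq[OF fin] sum.cartesian_product)
  qed
  \<comment> \<open>Colour 0 means membership in \<open>E1\<close>; by \<open>S_mem\<close>, colour
    1 implies membership in \<open>E2\<close>.\<close>
  have "mono_line k n (\<lambda>w. if S w \<in> E1 then 0 else 1 :: nat)"
    by (rule HJ_D[OF n]) simp
  then obtain v d where v: "v \<in> var_words k n"
    and d: "\<And>l. l < k \<Longrightarrow> (if S (subst_word l v) \<in> E1 then 0 else 1 :: nat) = d"
    unfolding mono_line_def by blast
  have len: "length v = n"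
    using v by (simp add: var_words_def)
  define I where "I = {i. i < n \<and> v ! i = None}"
  have I: "I \<subseteq> {..<n}"
    by (auto simp: I_def)
  have "I \<noteq> {}"
    using v by (auto simp: I_def var_words_def in_set_conv_nth)
  \<comment> \<open>The fixed positions of \<open>v\<close> contribute the same amount for every
    letter and go into the starting element; the variable positions, taken in every row of
    \<open>H\<close>, form \<open>G\<close>.\<close>
  define b where "b = a + (\<Sum>(t, i)\<in>H \<times> ({..<n} - I). M (pos (t, i)) (the (v ! i)))"
  define G where "G = pos ` (H \<times> I)"
  have "pos (t, i) \<in> {1..r * n}" if "t \<in> H" "i \<in> I" for t i
  proof -
    have "1 \<le> t" "t \<le> r" "i < n"
      using that H(2) I by auto
    then show ?thesis
      using block_le[of t r i n] by (simp add: pos_def)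
  qed
  then have G: "G \<noteq> {}" "G \<subseteq> {1..r * n}"
    using H(1) \<open>I \<noteq> {}\<close> by (auto simp: G_def)
  have inj: "inj_on pos (H \<times> I)"
    unfolding pos_def by (rule inj_on_subset[OF inj_on_block]) (use H I in auto)
  have S_eq: "S (subst_word l v) = add_sum b (\<lambda>s. M s l) G" for l
  proof -
    have "H \<times> {..<n} = H \<times> ({..<n} - I) \<union> H \<times> I"
      using I by blast
    then have "(\<Sum>(t, i)\<in>H \<times> {..<n}. M (pos (t, i)) (subst_word l v ! i)) =
        (\<Sum>(t, i)\<in>H \<times> ({..<n} - I). M (pos (t, i)) (subst_word l v ! i)) +
        (\<Sum>(t, i)\<in>H \<times> I. M (pos (t, i)) (subst_word l v ! i))"
      using fin finite_subset[OF I] by (simp only:) (intro sum.union_disjoint, auto)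
    also have "(\<Sum>(t, i)\<in>H \<times> ({..<n} - I). M (pos (t, i)) (subst_word l v ! i)) =
        (\<Sum>(t, i)\<in>H \<times> ({..<n} - I). M (pos (t, i)) (the (v ! i)))"
      by (intro sum.cong) (auto simp: nth_subst_word len I_def split: option.splits)
    also have "(\<Sum>(t, i)\<in>H \<times> I. M (pos (t, i)) (subst_word l v ! i)) = (\<Sum>s\<in>G. M s l)"
      unfolding G_def sum.reindex[OF inj]
      by (intro sum.cong) (auto simp: nth_subst_word len I_def split: option.splits)
    finally show ?thesis
      using fin finite_subset[OF I] by (simp add: S_def b_def add_sum_eq G_def add.assoc)
  qed
  show False
  proof (cases "d = 0")
    case True
    have "add_sum b (\<lambda>t. M1 t j) G \<in> E1" if "j \<in> {1..k1}" for j
    proof -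
      have "j - 1 < k1" "j - 1 < k" "Suc (j - 1) = j"
        using that by (auto simp: k_def)
      with d[of "j - 1"] True S_eq[of "j - 1"] show ?thesis
        by (simp add: M_def split: if_splits)
    qed
    with M1[OF G] show False by blast
  next
    case False
    have "add_sum b (\<lambda>t. M2 t j) G \<in> E2" if "j \<in> {1..k2}" for j
    proof -
      define l where "l = k1 + (j - 1)"
      have l: "l < k" "\<not> l < k1" "Suc (l - k1) = j"
        using that by (auto simp: k_def l_def)
      have "S (subst_word l v) \<notin> E1"
        using d[OF l(1)] False by (simp split: if_splits)
      with S_mem[OF subst_word_in_words[OF v l(1)]] S_eq[of l] l show ?thesis
        by (simp add: M_def)
    qed
    with M2[OF G] show False by blast
  qed
qed

section \<open>Idempotent ultrafilters below additive filters\<close>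

lemma ultrafilters_not_eventually:
  assumes "p \<in> ultrafilters"
  shows "\<not> eventually P p \<longleftrightarrow> eventually (\<lambda>x. \<not> P x) p"
proof
  assume "\<not> eventually P p"
  with assms show "eventually (\<lambda>x. \<not> P x) p"
    unfolding ultrafilters_def by (auto dest: spec[of _ "Collect P"])
next
  assume *: "eventually (\<lambda>x. \<not> P x) p"
  show "\<not> eventually P p"
  proof
    assume "eventually P p"
    with * have "eventually (\<lambda>x. False) p"
      by eventually_elim simp
    with assms show False
      by (simp add: ultrafilters_def trivial_limit_def)
  qed
qed

text \<open>The order is reversed, so maximal elements are minimal filters. The infimum of a
  nonempty chain has as members exactly the sets belonging to some filter of the chain; this is
  handed to the premise on chains as its third assumption.\<close>

lemma filter_Zorn:
  fixes F :: "'a filter"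
  assumes "Q F" and chain: "\<And>C. C \<noteq> {} \<Longrightarrow> (\<And>G. G \<in> C \<Longrightarrow> Q G) \<Longrightarrow>
    (\<And>P. eventually P (Inf C) \<longleftrightarrow> (\<exists>G\<in>C. eventually P G)) \<Longrightarrow> Q (Inf C)"
  obtains M where "M \<le> F" "Q M" "\<And>G. G \<le> M \<Longrightarrow> Q G \<Longrightarrow> G = M"
proof -
  define X where "X = {G. G \<le> F \<and> Q G}"
  have "\<exists>M\<in>X. \<forall>G\<in>X. M \<ge> G \<longrightarrow> G = M"
  proof (rule predicate_Zorn)
    show "partial_order_on X (relation_of (\<ge>) X)"
      by (auto simp: partial_order_on_def preorder_on_def refl_on_def trans_def antisym_def
          relation_of_def)
  next
    fix C assume C: "C \<in> Chains (relation_of (\<ge>) X)"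
    show "\<exists>u\<in>X. \<forall>a\<in>C. a \<ge> u"
    proof (cases "C = {}")
      case True
      with \<open>Q F\<close> show ?thesis
        by (auto simp: X_def)
    next
      case False
      have CX: "C \<subseteq> X"
        using C by (auto simp: Chains_def relation_of_def)
      have total: "G \<le> G' \<or> G' \<le> G" if "G \<in> C" "G' \<in> C" for G G'
        using C that by (auto simp: Chains_def relation_of_def)
      have "eventually P (Inf C) \<longleftrightarrow> (\<exists>G\<in>C. eventually P G)" for P
        using False total by (intro eventually_Inf_base) (metis inf.absorb1 inf.absorb2 order_refl)+
      then have "Q (Inf C)"
        using False CX by (intro chain) (auto simp: X_def)
      moreover have "Inf C \<le> F"
        using False CX by (metis (no_types, lifting) Inf_lower2 X_def ex_in_conv mem_Collect_eq subsetD)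
      ultimately show ?thesis
        by (auto simp: X_def Inf_lower)
    qed
  qed
  then show ?thesis
    using that by (fastforce simp: X_def)
qed

text \<open>A minimal proper filter decides every \<open>E\<close>: adding \<open>E\<close> either
  makes it improper, so it contains the complement, or leaves it unchanged.\<close>

lemma ultrafilter_below:
  fixes F :: "'a filter"
  assumes "F \<noteq> bot"
  obtains V where "V \<in> ultrafilters" "V \<le> F"
proof -
  obtain V where V: "V \<le> F" "V \<noteq> bot" "\<And>G. G \<le> V \<Longrightarrow> G \<noteq> bot \<Longrightarrow> G = V"
    using filter_Zorn[of "\<lambda>G. G \<noteq> bot" F] assms by (metis trivial_limit_def)
  have "eventually (\<lambda>x. x \<in> E) V \<or> eventually (\<lambda>x. x \<in> - E) V" for E
  proof (cases "inf V (principal E) = bot")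
    case True
    then show ?thesis
      by (simp add: trivial_limit_def eventually_inf_principal)
  next
    case False
    then have "inf V (principal E) = V"
      using V(3) by simp
    then show ?thesis
      by (metis eventually_principal inf.orderI le_principal)
  qed
  then have "V \<in> ultrafilters"
    using V(2) by (simp add: ultrafilters_def)
  with V(1) that show ?thesis by blast
qed

section \<open>The sum of arbitrary filters and its idempotents\<close>

lemma beta_add_mono: "p \<le> p' \<Longrightarrow> q \<le> q' \<Longrightarrow> beta_add p q \<le> beta_add p' q'"
  unfolding le_filter_def eventually_beta_add by (blast intro: eventually_mono)

lemma beta_add_neq_bot: "p \<noteq> bot \<Longrightarrow> q \<noteq> bot \<Longrightarrow> beta_add p q \<noteq> bot"
  by (simp add: trivial_limit_def eventually_beta_add)

lemma beta_add_assoc: "beta_add (beta_add p q) r = beta_add p (beta_add q r)"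
  by (simp add: filter_eq_iff eventually_beta_add add.assoc)

text \<open>Filter counterpart of a nonempty closed subsemigroup: by \<open>beta_add_mono\<close>,
  the ultrafilters refining such an \<open>F\<close> are closed under \<open>beta_add\<close>. The
  search for an idempotent below it is then an analogue of Ellis's theorem.\<close>

definition additive_filter :: "'a::ab_semigroup_add filter \<Rightarrow> bool" where
  "additive_filter F \<longleftrightarrow> F \<noteq> bot \<and> beta_add F F \<le> F"

text \<open>Regroup the double sum as \<open>M + (V + M) + V\<close>; since \<open>V\<close> refines
  \<open>M\<close>, the first part refines \<open>M + (M + M)\<close> and hence
  \<open>M\<close>.\<close>

lemma additive_filter_beta_add:
  assumes M: "additive_filter M" and V: "V \<in> ultrafilters" "V \<le> M"
  shows "additive_filter (beta_add M V)"
proof -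
  have MM: "beta_add M M \<le> M"
    using M by (simp add: additive_filter_def)
  have "beta_add (beta_add M V) (beta_add M V) = beta_add (beta_add M (beta_add V M)) V"
    by (simp add: beta_add_assoc)
  also have "\<dots> \<le> beta_add (beta_add M (beta_add M M)) V"
    using V by (intro beta_add_mono) auto
  also have "\<dots> \<le> beta_add M V"
    using MM by (meson beta_add_mono order_refl order_trans)
  finally show ?thesis
    using M V by (auto simp: additive_filter_def ultrafilters_def beta_add_neq_bot)
qed

text \<open>
  For a minimal additive filter \<open>M\<close> and an ultrafilter \<open>V \<le> M\<close>, minimality applied to
  \<open>M + V\<close> makes the filter generated by \<open>M\<close> and the sets \<open>{x. -x + A \<in> V}\<close> with \<open>A \<in> V\<close> proper;
  minimality applied to that filter puts all those sets into \<open>M\<close>, hence into \<open>V\<close>.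
\<close>

lemma idempotent_below_additive:
  fixes F :: "'a::ab_semigroup_add filter"
  assumes "additive_filter F"
  obtains V where "V \<in> ultrafilters" "V \<le> F" "beta_add V V = V"
proof -
  have chain: "additive_filter (Inf C)" if "C \<noteq> {}" "\<And>G. G \<in> C \<Longrightarrow> additive_filter G"
    and ev: "\<And>P. eventually P (Inf C) \<longleftrightarrow> (\<exists>G\<in>C. eventually P G)" for C :: "'a filter set"
  proof -
    have "beta_add (Inf C) (Inf C) \<le> G" if "G \<in> C" for G
      using \<open>G \<in> C\<close> \<open>\<And>G. G \<in> C \<Longrightarrow> additive_filter G\<close>
      by (meson Inf_lower additive_filter_def beta_add_mono order_trans)
    then show ?thesis
      using that by (auto simp: additive_filter_def trivial_limit_def le_Inf_iff)
  qed
  obtain M where M: "M \<le> F" "additive_filter M"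
    and min: "\<And>G. G \<le> M \<Longrightarrow> additive_filter G \<Longrightarrow> G = M"
    by (rule filter_Zorn[of additive_filter F, OF assms], rule chain, assumption+, rule that)
  obtain V where V: "V \<in> ultrafilters" "V \<le> M"
    using ultrafilter_below M(2) by (auto simp: additive_filter_def)
  have MM: "beta_add M M \<le> M"
    using M(2) by (simp add: additive_filter_def)
  have "beta_add M V \<le> M"
    using MM V(2) by (meson beta_add_mono order_refl order_trans)
  then have MV: "beta_add M V = M"
    using min additive_filter_beta_add[OF M(2) V] by blast
  \<comment> \<open>A single \<open>A\<close> suffices in this description, because the sets
    obtained from \<open>A\<close> and from \<open>B\<close> intersect in the one obtained from
    their intersection.\<close>
  define G where "G = Abs_filter (\<lambda>P. \<exists>A. eventually A V \<and>
    eventually (\<lambda>x. eventually (\<lambda>y. A (x + y)) V \<longrightarrow> P x) M)"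
  have ev_G: "eventually P G \<longleftrightarrow> (\<exists>A. eventually A V \<and>
    eventually (\<lambda>x. eventually (\<lambda>y. A (x + y)) V \<longrightarrow> P x) M)" for P
    unfolding G_def
  proof (rule eventually_Abs_filter, rule is_filter.intro)
    fix P Q :: "'a \<Rightarrow> bool"
    assume "\<exists>A. eventually A V \<and> eventually (\<lambda>x. eventually (\<lambda>y. A (x + y)) V \<longrightarrow> P x) M"
      "\<exists>A. eventually A V \<and> eventually (\<lambda>x. eventually (\<lambda>y. A (x + y)) V \<longrightarrow> Q x) M"
    then obtain A B where
      "eventually A V" "eventually (\<lambda>x. eventually (\<lambda>y. A (x + y)) V \<longrightarrow> P x) M"
      "eventually B V" "eventually (\<lambda>x. eventually (\<lambda>y. B (x + y)) V \<longrightarrow> Q x) M"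
      by blast
    then show "\<exists>A. eventually A V \<and>
        eventually (\<lambda>x. eventually (\<lambda>y. A (x + y)) V \<longrightarrow> P x \<and> Q x) M"
      by (intro exI[of _ "\<lambda>x. A x \<and> B x"]) (auto simp: eventually_conj_iff elim: eventually_elim2)
  qed (auto intro: eventually_mono exI[of _ "\<lambda>_. True"])
  have "G \<le> M"
    unfolding le_filter_def ev_G by (auto intro!: exI[of _ "\<lambda>_. True"])
  moreover have "additive_filter G"
    unfolding additive_filter_def
  proof
    show "G \<noteq> bot"
    proof
      assume "G = bot"
      \<comment> \<open>Improperness would put the complement of some \<open>A\<close> in
        \<open>V\<close> into \<open>M + V = M\<close>, and so into \<open>V\<close> as
        well.\<close>
      then obtain A where A: "eventually A V" "eventually (\<lambda>x. \<not> eventually (\<lambda>y. A (x + y)) V) M"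
        using ev_G[of "\<lambda>_. False"] by auto
      then have "eventually (\<lambda>z. \<not> A z) (beta_add M V)"
        by (simp add: eventually_beta_add ultrafilters_not_eventually[OF V(1)])
      then have "eventually (\<lambda>z. \<not> A z) V"
        using MV V(2) by (simp add: le_filter_def)
      with A(1) show False
        using ultrafilters_not_eventually[OF V(1)] by blast
    qed
  next
    show "beta_add G G \<le> G"
      unfolding le_filter_def
    proof (intro allI impI)
      fix P assume "eventually P G"
      then obtain A where A: "eventually A V"
        "eventually (\<lambda>x. eventually (\<lambda>y. A (x + y)) V \<longrightarrow> P x) M"
        unfolding ev_G by blast
      then have "eventually (\<lambda>a. eventually (\<lambda>b. eventually (\<lambda>y. A (a + b + y)) V \<longrightarrow> P (a + b)) M) M"
        using MM unfolding le_filter_def eventually_beta_add by blast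
      \<comment> \<open>If the translate of \<open>A\<close> by \<open>-a\<close> lies in
        \<open>V\<close>, then this translate is itself the witness that \<open>P (a + b)\<close>
        holds eventually for \<open>b\<close> in \<open>G\<close>.\<close>
      then have "eventually (\<lambda>a. eventually (\<lambda>y. A (a + y)) V \<longrightarrow> eventually (\<lambda>b. P (a + b)) G) M"
      proof eventually_elim
        case (elim a)
        then show ?case
          by (auto simp: ev_G add.assoc intro!: exI[of _ "\<lambda>y. A (a + y)"])
      qed
      with A(1) show "eventually P (beta_add G G)"
        unfolding eventually_beta_add ev_G[of "\<lambda>a. eventually (\<lambda>b. P (a + b)) G"] by blast
    qed
  qed
  ultimately have GM: "G = M"
    by (rule min)
  have up: "eventually A (beta_add V V)" if "eventually A V" for A
  proof -
    have "eventually (\<lambda>x. eventually (\<lambda>y. A (x + y)) V) G"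
      unfolding ev_G using that by auto
    then show ?thesis
      using GM V(2) by (simp add: eventually_beta_add le_filter_def)
  qed
  \<comment> \<open>By \<open>up\<close>, \<open>beta_add V V\<close> refines \<open>V\<close>; both
    are ultrafilters, so they coincide.\<close>
  have "beta_add V V = V"
    unfolding filter_eq_iff
    using up ultrafilters_not_eventually[OF V(1)]
      ultrafilters_not_eventually[OF beta_add_in_ultrafilters[OF V(1) V(1)]] by blast
  with V M(1) that show ?thesis
    using order_trans by blast
qed

section \<open>Preimages of essential CR-sets\<close>

lemma int_preimage_mono: "B \<subseteq> B' \<Longrightarrow> int_preimage A B \<subseteq> int_preimage A B'"
  unfolding int_preimage_def by blast

lemma matrix_vector_mult_of_int_add:
  fixes A :: "rat ^ 'v::finite ^ 'u::finite"
  shows "A *v (\<chi> j. rat_of_int ((x + y) $ j)) =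
    A *v (\<chi> j. rat_of_int (x $ j)) + A *v (\<chi> j. rat_of_int (y $ j))"
  by (simp add: vec_eq_iff matrix_vector_mult_def distrib_left sum.distrib)

text \<open>Row \<open>i\<close> of the image of \<open>x\<close> is an integer \<open>n i\<close>
  for which the translate of \<open>B\<close> by \<open>-n i\<close> lies in \<open>p\<close>. There
  are finitely many rows, so the intersection of these translates lies in \<open>p\<close> and
  serves as \<open>B'\<close>; linearity does the rest.\<close>

lemma int_preimage_translate:
  fixes A :: "rat ^ 'v::finite ^ 'u::finite" and p :: "int filter"
  assumes x: "x \<in> int_preimage A {n. eventually (\<lambda>m. n + m \<in> B) p}"
  obtains B' where "eventually (\<lambda>m. m \<in> B') p"
    "\<And>y. y \<in> int_preimage A B' \<Longrightarrow> x + y \<in> int_preimage A B"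
proof -
  have "\<forall>i. \<exists>n. (A *v (\<chi> j. rat_of_int (x $ j))) $ i = rat_of_int n \<and>
      eventually (\<lambda>m. n + m \<in> B) p"
    using x by (auto simp: int_preimage_def)
  then obtain n where n: "\<And>i. (A *v (\<chi> j. rat_of_int (x $ j))) $ i = rat_of_int (n i)"
    "\<And>i. eventually (\<lambda>m. n i + m \<in> B) p"
    by metis
  show ?thesis
  proof
    show "eventually (\<lambda>m. m \<in> {m. \<forall>i. n i + m \<in> B}) p"
      using n(2) by (simp add: eventually_all_finite)
  next
    fix y assume y: "y \<in> int_preimage A {m. \<forall>i. n i + m \<in> B}"
    have "(A *v (\<chi> j. rat_of_int ((x + y) $ j))) $ i \<in> rat_of_int ` B" for i
    proof -
      obtain m where m: "(A *v (\<chi> j. rat_of_int (y $ j))) $ i = rat_of_int m" "n i + m \<in> B"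
        using y by (auto simp: int_preimage_def)
      then have "(A *v (\<chi> j. rat_of_int ((x + y) $ j))) $ i = rat_of_int (n i + m)"
        unfolding matrix_vector_mult_of_int_add by (simp add: n(1))
      with m(2) show ?thesis by blast
    qed
    then show "x + y \<in> int_preimage A B"
      by (simp add: int_preimage_def)
  qed
qed

theorem theorem2p7:
  fixes A :: "rat ^ 'v::finite ^ 'u::finite"
  assumes "\<And>B :: int set. CR_set B \<Longrightarrow> CR_set (int_preimage A B)"
  shows "\<forall>C :: int set. essential_CR_set C \<longrightarrow> essential_CR_set (int_preimage A C)"
proof (intro allI impI)
  fix C :: "int set"
  assume "essential_CR_set C"
  then obtain p where C: "eventually (\<lambda>x. x \<in> C) p" and p: "p \<in> CR_ultrafilters"
    and idem: "p = beta_add p p"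
    unfolding essential_CR_set_def beta_closure_def by blast
  have CR_p: "CR_set (int_preimage A B)" if "eventually (\<lambda>x. x \<in> B) p" for B
    using p that assms by (simp add: CR_ultrafilters_def)
  \<comment> \<open>The sets that are not CR form an ideal. \<open>F\<close> is generated by the
    preimages of members of \<open>p\<close> and the complements of the sets in this ideal.\<close>
  define F where "F = Abs_filter (\<lambda>P. \<exists>B. eventually (\<lambda>x. x \<in> B) p \<and>
    \<not> CR_set {y \<in> int_preimage A B. \<not> P y})"
  have ev_F: "eventually P F \<longleftrightarrow> (\<exists>B. eventually (\<lambda>x. x \<in> B) p \<and>
    \<not> CR_set {y \<in> int_preimage A B. \<not> P y})" for P
    unfolding F_def
  proof (rule eventually_Abs_filter, rule is_filter.intro)
    show "\<exists>B. eventually (\<lambda>x. x \<in> B) p \<and> \<not> CR_set {y \<in> int_preimage A B. \<not> True}"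
      by (auto simp: not_CR_set_empty intro!: exI[of _ UNIV])
  next
    fix P Q
    assume "\<exists>B. eventually (\<lambda>x. x \<in> B) p \<and> \<not> CR_set {y \<in> int_preimage A B. \<not> P y}"
      "\<exists>B. eventually (\<lambda>x. x \<in> B) p \<and> \<not> CR_set {y \<in> int_preimage A B. \<not> Q y}"
    then obtain B B' where B: "eventually (\<lambda>x. x \<in> B) p" "eventually (\<lambda>x. x \<in> B') p"
      and not_CR: "\<not> CR_set {y \<in> int_preimage A B. \<not> P y}"
        "\<not> CR_set {y \<in> int_preimage A B'. \<not> Q y}"
      by blast
    have sub: "{y \<in> int_preimage A (B \<inter> B'). \<not> (P y \<and> Q y)} \<subseteq>
        {y \<in> int_preimage A B. \<not> P y} \<union> {y \<in> int_preimage A B'. \<not> Q y}"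
      using int_preimage_mono[of "B \<inter> B'" B A] int_preimage_mono[of "B \<inter> B'" B' A] by blast
    have "\<not> CR_set {y \<in> int_preimage A (B \<inter> B'). \<not> (P y \<and> Q y)}"
      using CR_set_Un[OF CR_set_mono[OF _ sub]] not_CR by argo
    with B show "\<exists>B. eventually (\<lambda>x. x \<in> B) p \<and>
        \<not> CR_set {y \<in> int_preimage A B. \<not> (P y \<and> Q y)}"
      by (intro exI[of _ "B \<inter> B'"]) (simp add: eventually_conj_iff)
  next
    fix P Q :: "int ^ 'v \<Rightarrow> bool"
    assume "\<forall>x. P x \<longrightarrow> Q x"
    then have "{y \<in> int_preimage A B. \<not> Q y} \<subseteq> {y \<in> int_preimage A B. \<not> P y}" for B
      by blast
    moreover assume "\<exists>B. eventually (\<lambda>x. x \<in> B) p \<and> \<not> CR_set {y \<in> int_preimage A B. \<not> P y}"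
    ultimately show "\<exists>B. eventually (\<lambda>x. x \<in> B) p \<and> \<not> CR_set {y \<in> int_preimage A B. \<not> Q y}"
      using CR_set_mono by meson
  qed
  have "additive_filter F"
    unfolding additive_filter_def
  proof
    \<comment> \<open>The hypothesis on \<open>A\<close> enters here: an improper \<open>F\<close>
      would mean that the preimage of some member of \<open>p\<close> is not CR.\<close>
    show "F \<noteq> bot"
      using CR_p by (simp add: trivial_limit_def ev_F)
    show "beta_add F F \<le> F"
      unfolding le_filter_def
    proof (intro allI impI)
      fix P assume "eventually P F"
      then obtain B where B: "eventually (\<lambda>x. x \<in> B) p"
        and not_CR: "\<not> CR_set {y \<in> int_preimage A B. \<not> P y}"
        unfolding ev_F by blast
      \<comment> \<open>Idempotency puts this set into \<open>p\<close>. Every \<open>x\<close> in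
        its preimage satisfies the inner condition of \<open>F + F\<close>, so the set of exceptions
        is empty and in particular not CR.\<close>
      let ?B' = "{n. eventually (\<lambda>m. n + m \<in> B) p}"
      have "eventually (\<lambda>n. n \<in> ?B') p"
        using B idem eventually_beta_add[of "\<lambda>n. n \<in> B" p p] by simp
      moreover have "eventually (\<lambda>y. P (x + y)) F" if x: "x \<in> int_preimage A ?B'" for x
      proof -
        obtain B'' where B'': "eventually (\<lambda>m. m \<in> B'') p"
          "\<And>y. y \<in> int_preimage A B'' \<Longrightarrow> x + y \<in> int_preimage A B"
          using int_preimage_translate[OF x] by blast
        \<comment> \<open>The exceptions for \<open>x\<close> lie in a translate of the exceptional
          set of \<open>P\<close>, which is not CR.\<close>
        have "\<not> CR_set {y. x + y \<in> {y \<in> int_preimage A B. \<not> P y}}"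
          by (rule contrapos_nn[OF not_CR]) (erule CR_set_translate)
        moreover have "{y \<in> int_preimage A B''. \<not> P (x + y)} \<subseteq>
            {y. x + y \<in> {y \<in> int_preimage A B. \<not> P y}}"
          using B''(2) by blast
        ultimately have "\<not> CR_set {y \<in> int_preimage A B''. \<not> P (x + y)}"
          using CR_set_mono by blast
        with B''(1) show ?thesis
          unfolding ev_F by (intro exI[of _ B''] conjI)
      qed
      then have "{x \<in> int_preimage A ?B'. \<not> eventually (\<lambda>y. P (x + y)) F} = {}"
        by blast
      then have "\<not> CR_set {x \<in> int_preimage A ?B'. \<not> eventually (\<lambda>y. P (x + y)) F}"
        by (simp only: not_CR_set_empty not_False_eq_True)
      ultimately show "eventually P (beta_add F F)"
        unfolding eventually_beta_add ev_F[of "\<lambda>x. eventually (\<lambda>y. P (x + y)) F"]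
        by (intro exI[of _ ?B'] conjI)
    qed
  qed
  then obtain q where q: "q \<in> ultrafilters" "q \<le> F" "beta_add q q = q"
    using idempotent_below_additive by blast
  have "CR_set E" if E: "eventually (\<lambda>y. y \<in> E) q" for E
  proof (rule ccontr)
    assume "\<not> CR_set E"
    \<comment> \<open>Any member of \<open>p\<close> would do in place of \<open>C\<close>: the
      complement of a set that is not CR always belongs to \<open>F\<close>.\<close>
    moreover have "{y \<in> int_preimage A C. \<not> y \<notin> E} \<subseteq> E"
      by blast
    ultimately have "\<not> CR_set {y \<in> int_preimage A C. \<not> y \<notin> E}"
      using CR_set_mono by blast
    with C have "eventually (\<lambda>y. y \<notin> E) F"
      unfolding ev_F by (intro exI[of _ C] conjI)
    with q E show False
      using ultrafilters_not_eventually[OF q(1)] by (auto simp: le_filter_def)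
  qed
  then have "q \<in> CR_ultrafilters"
    using q(1) by (simp add: CR_ultrafilters_def)
  moreover have "{y \<in> int_preimage A C. y \<notin> int_preimage A C} = {}"
    by blast
  then have "eventually (\<lambda>y. y \<in> int_preimage A C) F"
    unfolding ev_F using C not_CR_set_empty by (intro exI[of _ C] conjI) simp_all
  then have "q \<in> beta_closure (int_preimage A C)"
    using q by (simp add: beta_closure_def le_filter_def)
  ultimately show "essential_CR_set (int_preimage A C)"
    unfolding essential_CR_set_def by (intro bexI[of _ q] IntI q(3)[symmetric])
qed

end
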